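(* Let $C$ and $n$ be positive integers and let $\mathsf{EDP}(C,n)$ be the CNF formula defined in the context. For any assignment $I:\{p_1,\dots,p_n\}\to\{0,1\}$ the following are equivalent: (a) there is an assignment $I'$ to $\{p_1,\dots,p_n\}$ together with all propositions occurring in $\mathsf{EDP}(C,n)$, agreeing with $I$ on $p_1,\dots,p_n$, that satisfies $\mathsf{EDP}(C,n)$; (b) the $\pm1$ sequence $x_1,\dots,x_n$ given by $x_i=2I(p_i)-1$ has discrepancy at most $C$.
   Context: The discrepancy of a finite $\pm1$ sequence $x_1,\dots,x_n$ is $\max\{|\sum_{i=1}^k x_{i\cdot d}| : d,k\ge 1,\ kd\le n\}$. For a list of propositional variables $q_1,\dots,q_m$ and fresh auxiliary variables $s^k_j$ ($0\le k,j\le m$), let $S$ be the set of clauses consisting of: for all $1\le k\le m$, $1\le j\le m$, the four clauses $(\lnot s^k_j\lor s^k_{j-1}\lor s^{k-1}_{j-1})$, $(\lnot s^k_j\lor s^k_{j-1}\lor q_j)$, $(\lnot s^k_{j-1}\lor s^k_j)$, $(\lnot s^{k-1}_{j-1}\lor\lnot q_j\lor s^k_j)$; the unit clauses $(\lnot s^k_j)$ for $0\le j<k\le m$; $(s^0_j)$ for $0\le j\le m$; $(s^k_j)$ for $1\le k\le m$, $2k-2+C<j\le m$; and $(\lnot s^k_j)$ for $1\le k\le m$, $0\le j<2k-C$. Let $\mathsf{CBound}^C(q_1,\dots,q_m)$ be the clause set obtained from $S$ by exhaustive unit propagation (repeatedly, for a unit clause $(l)$, fix $l$ to true: delete all clauses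 containing $l$ and delete $\lnot l$ from the remaining clauses). Define $\mathsf{EDP}(C,n)=\bigwedge_{d=1}^{\lfloor n/(C+1)\rfloor}\mathsf{CBound}^C(p_d,p_{2d},\dots,p_{\lfloor n/d\rfloor\cdot d})$, where the different conjuncts share the input variables $p_1,\dots,p_n$ but use pairwise disjoint sets of auxiliary variables. *)

theory Defs
  imports Main
begin

datatype 'v literal = Pos 'v | Neg 'v

fun negate :: "'v literal \<Rightarrow> 'v literal" where
  "negate (Pos v) = Neg v"
| "negate (Neg v) = Pos v"

type_synonym 'v clause = "'v literal set"
type_synonym 'v cnf = "'v clause set"

fun lit_true :: "('v \<Rightarrow> bool) \<Rightarrow> 'v literal \<Rightarrow> bool" where
  "lit_true I (Pos v) \<longleftrightarrow> I v"
| "lit_true I (Neg v) \<longleftrightarrow> \<not> I v"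

definition satisfies :: "('v \<Rightarrow> bool) \<Rightarrow> 'v cnf \<Rightarrow> bool" where
  "satisfies I F \<longleftrightarrow> (\<forall>c\<in>F. \<exists>l\<in>c. lit_true I l)"

definition fix_literal :: "'v literal \<Rightarrow> 'v cnf \<Rightarrow> 'v cnf" where
  "fix_literal l F = {c - {negate l} | c. c \<in> F \<and> l \<notin> c}"

inductive up_step :: "'v cnf \<Rightarrow> 'v cnf \<Rightarrow> bool" where
  "{l} \<in> F \<Longrightarrow> up_step F (fix_literal l F)"

definition up_result :: "'v cnf \<Rightarrow> 'v cnf \<Rightarrow> bool" where
  "up_result F G \<longleftrightarrow> up_step\<^sup>*\<^sup>* F G \<and> (\<forall>l. {l} \<notin> G)"

text \<open>
  A result exists for every finite clause set and does not depend on the order of propagation if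
  the clause set is satisfiable; see \<open>up_result_exists\<close> and \<open>up_result_unique\<close> below.
\<close>

definition unit_propagation :: "'v cnf \<Rightarrow> 'v cnf" where
  "unit_propagation F = (SOME G. up_result F G)"

lemma negate_negate [simp]: "negate (negate l) = l"
  by (cases l) auto

lemma negate_neq [simp]: "negate l \<noteq> l" "l \<noteq> negate l"
  by (cases l; simp)+

lemma lit_true_negate [simp]: "lit_true I (negate l) \<longleftrightarrow> \<not> lit_true I l"
  by (cases l) auto

lemma up_result_exists:
  assumes "finite (\<Union>F)"
  shows "\<exists>G. up_result F G"
  using assms
proof (induction "card (\<Union>F)" arbitrary: F rule: less_induct)
  case less
  show ?case
  proof (cases "\<exists>l. {l} \<in> F")
    case False
    then show ?thesis by (auto simp: up_result_def)
  next
    case True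
    then obtain l where l: "{l} \<in> F" by blast
    let ?G = "fix_literal l F"
    have sub: "\<Union>?G \<subset> \<Union>F"
      using l by (auto simp: fix_literal_def)
    then have "finite (\<Union>?G)" "card (\<Union>?G) < card (\<Union>F)"
      using less.prems by (auto intro: finite_subset psubset_card_mono)
    then obtain H where "up_result ?G H" using less.hyps by blast
    moreover have "up_step F ?G" using l by (rule up_step.intros)
    ultimately show ?thesis
      unfolding up_result_def by (meson converse_rtranclp_into_rtranclp)
  qed
qed

lemma up_result_unit_propagation:
  "finite (\<Union>F) \<Longrightarrow> up_result F (unit_propagation F)"
  unfolding unit_propagation_def by (rule someI_ex) (rule up_result_exists)

lemma satisfies_fix_literal:
  assumes "satisfies I F" "{l} \<in> F"
  shows "satisfies I (fix_literal l F)"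
proof -
  have "lit_true I l" using assms unfolding satisfies_def by force
  then show ?thesis
    using assms(1) unfolding satisfies_def fix_literal_def
    by clarsimp (metis DiffI lit_true_negate singletonD)
qed

lemma fix_literal_commute:
  assumes "l \<noteq> negate m" "m \<noteq> negate l"
  shows "fix_literal l (fix_literal m F) = fix_literal m (fix_literal l F)"
proof -
  have "fix_literal a (fix_literal b F) =
      {c - {negate a, negate b} | c. c \<in> F \<and> a \<notin> c \<and> b \<notin> c}"
    if "a \<noteq> negate b" for a b :: "'a literal" and F
  proof -
    have "c - {negate b} - {negate a} = c - {negate a, negate b}"
      "a \<notin> c - {negate b} \<longleftrightarrow> a \<notin> c" for c
      using that by auto
    note eqs = this
    have "fix_literal a (fix_literal b F) =
        {c - {negate b} - {negate a} | c. c \<in> F \<and> a \<notin> c - {negate b} \<and> b \<notin> c}"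
      unfolding fix_literal_def by blast
    then show ?thesis by (simp only: eqs)
  qed
  from this[OF assms(1), of F] this[OF assms(2), of F] show ?thesis
    by (simp add: insert_commute conj_commute)
qed

lemma up_step_diamond:
  assumes "satisfies I F" "up_step F G" "up_step F H" "G \<noteq> H"
  shows "\<exists>K. up_step G K \<and> up_step H K"
proof -
  obtain l m where l: "{l} \<in> F" "G = fix_literal l F" and m: "{m} \<in> F" "H = fix_literal m F"
    using assms(2,3) by (auto elim!: up_step.cases)
  have "lit_true I l" "lit_true I m"
    using assms(1) l(1) m(1) unfolding satisfies_def by force+
  then have ne: "l \<noteq> negate m" "m \<noteq> negate l" by auto
  have "l \<noteq> m" using assms(4) l m by blast
  then have "{m} \<in> G" "{l} \<in> H"
    using l m ne unfolding fix_literal_def by fastforce+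
  then show ?thesis
    using fix_literal_commute[OF ne] l m by (metis up_step.intros)
qed

lemma up_strip:
  assumes "up_step\<^sup>*\<^sup>* F H" "up_step F G" "satisfies I F" "\<forall>l. {l} \<notin> H"
  shows "up_step\<^sup>*\<^sup>* G H"
  using assms
proof (induction arbitrary: G rule: converse_rtranclp_induct)
  case base
  then show ?case by (auto elim: up_step.cases)
next
  case (step F F')
  have sat: "satisfies I F'"
    using step.hyps(1) step.prems(2) by (auto elim!: up_step.cases intro: satisfies_fix_literal)
  show ?case
  proof (cases "F' = G")
    case True
    then show ?thesis using step.hyps(2) by simp
  next
    case False
    then obtain K where "up_step F' K" "up_step G K"
      using up_step_diamond[OF step.prems(2) step.hyps(1) step.prems(1)] by blast
    then show ?thesis
      using step.IH[OF _ sat step.prems(3)] by (meson converse_rtranclp_into_rtranclp)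
  qed
qed

lemma up_result_unique:
  assumes "satisfies I F" "up_result F G" "up_result F H"
  shows "G = H"
proof -
  have "up_step\<^sup>*\<^sup>* F G" using assms(2) by (simp add: up_result_def)
  then show ?thesis
    using assms(1,3)
  proof (induction rule: converse_rtranclp_induct)
    case base
    have "\<not> up_step G K" for K
      using assms(2) by (auto simp: up_result_def elim: up_step.cases)
    then show ?case
      using base.prems(2) unfolding up_result_def by (meson converse_rtranclpE)
  next
    case (step F F')
    have "satisfies I F'"
      using step.hyps(1) step.prems(1) by (auto elim!: up_step.cases intro: satisfies_fix_literal)
    moreover have "up_result F' H"
      using step.prems up_strip[OF _ step.hyps(1) step.prems(1)] by (auto simp: up_result_def)
    ultimately show ?case by (rule step.IH)
  qed
qed

text \<open>
  The inputs are \<open>q 1, \<dots>, q m\<close>; \<open>s k j\<close> is the auxiliary variable with upper index \<open>k\<close> and lower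
  index \<open>j\<close>, intended to say that at least \<open>k\<close> of \<open>q 1, \<dots>, q j\<close> are true. In the last set the
  truncated difference is harmless (there is no \<open>j\<close> when \<open>2 * k \<le> C\<close>), and \<open>j \<le> m\<close> is
  the range in which the auxiliary variables exist.
\<close>

definition counter_clauses ::
  "nat \<Rightarrow> nat \<Rightarrow> (nat \<Rightarrow> 'v) \<Rightarrow> (nat \<Rightarrow> nat \<Rightarrow> 'v) \<Rightarrow> 'v cnf" where
  "counter_clauses C m q s =
     {{Neg (s k j), Pos (s k (j - 1)), Pos (s (k - 1) (j - 1))} | k j. k \<in> {1..m} \<and> j \<in> {1..m}}
   \<union> {{Neg (s k j), Pos (s k (j - 1)), Pos (q j)} | k j. k \<in> {1..m} \<and> j \<in> {1..m}}
   \<union> {{Neg (s k (j - 1)), Pos (s k j)} | k j. k \<in> {1..m} \<and> j \<in> {1..m}}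
   \<union> {{Neg (s (k - 1) (j - 1)), Neg (q j), Pos (s k j)} | k j. k \<in> {1..m} \<and> j \<in> {1..m}}
   \<union> {{Neg (s k j)} | k j. j < k \<and> k \<le> m}
   \<union> {{Pos (s 0 j)} | j. j \<le> m}
   \<union> {{Pos (s k j)} | k j. k \<in> {1..m} \<and> 2 * k - 2 + C < j \<and> j \<le> m}
   \<union> {{Neg (s k j)} | k j. k \<in> {1..m} \<and> j < 2 * k - C \<and> j \<le> m}"

definition CBound ::
  "nat \<Rightarrow> nat \<Rightarrow> (nat \<Rightarrow> 'v) \<Rightarrow> (nat \<Rightarrow> nat \<Rightarrow> 'v) \<Rightarrow> 'v cnf" where
  "CBound C m q s = unit_propagation (counter_clauses C m q s)"

text \<open>\<open>Aux d k j\<close> is the variable \<open>s k j\<close> of the conjunct for difference \<open>d\<close>.\<close>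

datatype edp_var = Inp nat | Aux nat nat nat

definition EDP :: "nat \<Rightarrow> nat \<Rightarrow> edp_var cnf" where
  "EDP C n = (\<Union>d\<in>{1..n div (C + 1)}. CBound C (n div d) (\<lambda>i. Inp (i * d)) (Aux d))"

text \<open>Sequences are indexed from 1: only \<open>x 1, \<dots>, x n\<close> matter.\<close>

definition discrepancy :: "nat \<Rightarrow> (nat \<Rightarrow> int) \<Rightarrow> int" where
  "discrepancy n x = Max {\<bar>\<Sum>i=1..k. x (i * d)\<bar> | d k. d \<ge> 1 \<and> k \<ge> 1 \<and> k * d \<le> n}"

end

theory Submission
  imports Defs
begin

text \<open>
  The clauses of the counter force \<open>s k j\<close> to mean that at least \<open>k\<close> of \<open>q 1, \<dots>, q j\<close> are true, so
  that its unit clauses say that every prefix sum is at most \<open>C\<close> in absolute value. Unit propagation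
  preserves models, but it forgets the values of the propagated variables. No information on the
  inputs is lost because no input is ever propagated: a propagated literal is true in all models,
  while for \<open>C \<ge> 1\<close> both alternating sequences extend to models and give every input both values.
  For \<open>d > n div (C + 1)\<close> the progressions have at most \<open>C\<close> terms, so no conjunct is needed.
\<close>

section \<open>Transfer of models through unit propagation\<close>

lemma satisfies_fix_literalD:
  assumes "satisfies J (fix_literal l F)"
  shows "satisfies (case l of Pos v \<Rightarrow> J(v := True) | Neg v \<Rightarrow> J(v := False)) F" (is "satisfies ?K F")
  unfolding satisfies_def
proof
  fix c assume c: "c \<in> F"
  have l: "lit_true ?K l" by (cases l) auto
  show "\<exists>k\<in>c. lit_true ?K k"
  proof (cases "l \<in> c")
    case True
    then show ?thesis using l by blast
  next
    case False
    then have "c - {negate l} \<in> fix_literal l F" using c unfolding fix_literal_def by blast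
    then obtain k where k: "k \<in> c" "k \<noteq> negate l" "lit_true J k"
      using assms unfolding satisfies_def by blast
    \<comment> \<open>As \<open>k\<close> differs from \<open>negate l\<close>, overwriting the
      variable of \<open>l\<close> cannot falsify it.\<close>
    then have "lit_true ?K k" by (cases l; cases k) auto
    then show ?thesis using k by blast
  qed
qed

lemma satisfies_up_steps:
  assumes "up_step\<^sup>*\<^sup>* F G" "satisfies I F"
  shows "satisfies I G"
  using assms
proof (induction rule: rtranclp_induct)
  case (step G H)
  then obtain l where "{l} \<in> G" "H = fix_literal l G" by (auto elim: up_step.cases)
  then show ?case using step satisfies_fix_literal by metis
qed

text \<open>Undoing the steps one by one overwrites only variables of propagated literals. Since
  each variable in \<open>V\<close> takes both values in models of \<open>F\<close>, none of them is
  ever propagated.\<close>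

lemma satisfies_up_steps_extend:
  assumes "up_step\<^sup>*\<^sup>* F G" "satisfies I G"
    and "\<And>v b. v \<in> V \<Longrightarrow> \<exists>M. satisfies M F \<and> M v = b"
  shows "\<exists>J. (\<forall>v\<in>V. J v = I v) \<and> satisfies J F"
  using assms
proof (induction rule: converse_rtranclp_induct)
  case base
  then show ?case by blast
next
  case (step F F')
  obtain l where l: "{l} \<in> F" "F' = fix_literal l F"
    using step.hyps(1) by (auto elim: up_step.cases)
  \<comment> \<open>Models of \<open>F\<close> remain models of \<open>F'\<close>, so the hypothesis
    on \<open>V\<close> is inherited.\<close>
  have "\<exists>M. satisfies M F' \<and> M v = b" if v: "v \<in> V" for v b
  proof -
    obtain M where "satisfies M F" "M v = b" using step.prems(2)[OF v, of b] by blast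
    then show ?thesis using satisfies_fix_literal[of M F l] l by auto
  qed
  then obtain J where J: "\<forall>v\<in>V. J v = I v" "satisfies J F'"
    using step.IH step.prems(1) by blast
  let ?K = "case l of Pos v \<Rightarrow> J(v := True) | Neg v \<Rightarrow> J(v := False)"
  have lit: "lit_true M l" if "satisfies M F" for M
    using that l(1) unfolding satisfies_def by force
  have "v \<notin> V" if "l = Pos v \<or> l = Neg v" for v
  proof
    assume "v \<in> V"
    \<comment> \<open>The value \<open>l = Neg v\<close> is the one that makes the unit literal
      \<open>l\<close> false.\<close>
    then obtain M where "satisfies M F" "M v = (l = Neg v)"
      using step.prems(2) by blast
    then show False using lit[of M] that by auto
  qed
  then have "\<forall>v\<in>V. ?K v = I v"
    using J(1) by (cases l) auto
  moreover have "satisfies ?K F"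
    using J(2) unfolding l(2) by (rule satisfies_fix_literalD)
  ultimately show ?case by blast
qed

section \<open>Counting true entries and sums of signs\<close>

definition true_count :: "(nat \<Rightarrow> bool) \<Rightarrow> nat \<Rightarrow> nat" where
  "true_count b j = (\<Sum>i=1..j. of_bool (b i))"

lemma true_count_0 [simp]: "true_count b 0 = 0"
  by (simp add: true_count_def)

lemma true_count_Suc [simp]: "true_count b (Suc j) = true_count b j + of_bool (b (Suc j))"
  by (simp add: true_count_def)

lemma true_count_le: "true_count b j \<le> j"
  by (induction j) auto

lemma sum_signs_eq: "(\<Sum>i=1..j. 2 * of_bool (b i) - 1 :: int) = 2 * int (true_count b j) - int j"
  by (induction j) auto

text \<open>Consecutive signs cancel, so each prefix sum is 0 or the first sign; \<open>e\<close>
  selects one of the two alternating sequences.\<close>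

lemma true_count_alternating:
  "\<bar>2 * int (true_count (\<lambda>i. even i = e) j) - int j\<bar> \<le> 1"
proof -
  have "2 * int (true_count (\<lambda>i. even i = e) j) - int j
      = (if even j then 0 else if e then - 1 else 1)"
    by (induction j) auto
  then show ?thesis by simp
qed

section \<open>Meaning of the counter clauses\<close>

lemma satisfies_Un: "satisfies I (F \<union> G) \<longleftrightarrow> satisfies I F \<and> satisfies I G"
  unfolding satisfies_def by blast

lemma satisfies_family:
  "satisfies I {f j | j. P j} \<longleftrightarrow> (\<forall>j. P j \<longrightarrow> (\<exists>l\<in>f j. lit_true I l))"
  by (auto simp: satisfies_def)

lemma satisfies_family2:
  "satisfies I {g k j | k j. Q k j} \<longleftrightarrow> (\<forall>k j. Q k j \<longrightarrow> (\<exists>l\<in>g k j. lit_true I l))"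
  by (auto simp: satisfies_def)

lemma satisfies_counter_clauses_unfold:
  "satisfies I (counter_clauses C m q s) \<longleftrightarrow>
     (\<forall>k j. k \<in> {1..m} \<and> j \<in> {1..m} \<longrightarrow> I (s k j) \<longrightarrow> I (s k (j - 1)) \<or> I (s (k - 1) (j - 1))) \<and>
     (\<forall>k j. k \<in> {1..m} \<and> j \<in> {1..m} \<longrightarrow> I (s k j) \<longrightarrow> I (s k (j - 1)) \<or> I (q j)) \<and>
     (\<forall>k j. k \<in> {1..m} \<and> j \<in> {1..m} \<longrightarrow> I (s k (j - 1)) \<longrightarrow> I (s k j)) \<and>
     (\<forall>k j. k \<in> {1..m} \<and> j \<in> {1..m} \<longrightarrow> I (s (k - 1) (j - 1)) \<longrightarrow> I (q j) \<longrightarrow> I (s k j)) \<and>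
     (\<forall>k j. j < k \<and> k \<le> m \<longrightarrow> \<not> I (s k j)) \<and>
     (\<forall>j. j \<le> m \<longrightarrow> I (s 0 j)) \<and>
     (\<forall>k j. k \<in> {1..m} \<and> 2 * k - 2 + C < j \<and> j \<le> m \<longrightarrow> I (s k j)) \<and>
     (\<forall>k j. k \<in> {1..m} \<and> j < 2 * k - C \<and> j \<le> m \<longrightarrow> \<not> I (s k j))"
  unfolding counter_clauses_def satisfies_Un satisfies_family satisfies_family2 bex_simps
    lit_true.simps imp_conv_disj conj_assoc by simp

text \<open>The three-literal and monotonicity clauses encode the recurrence of a counter, and the
  units for \<open>j < k\<close> and \<open>k = 0\<close> fix its boundary. Once \<open>s\<close> is
  the counter, the two remaining unit families bound the prefix sums from below and above.\<close>

lemma satisfies_counter_clauses_iff: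
  "satisfies I (counter_clauses C m q s) \<longleftrightarrow>
     (\<forall>k\<le>m. \<forall>j\<le>m. I (s k j) \<longleftrightarrow> k \<le> true_count (I \<circ> q) j) \<and>
     (\<forall>j\<le>m. \<bar>2 * int (true_count (I \<circ> q) j) - int j\<bar> \<le> int C)" (is "?L \<longleftrightarrow> ?A \<and> ?B")
proof
  let ?c = "true_count (I \<circ> q)"
  assume ?L
  then have
    ex: "\<And>k j. \<lbrakk>k \<in> {1..m}; j \<in> {1..m}; I (s k j)\<rbrakk> \<Longrightarrow> I (s k (j - 1)) \<or> I (s (k - 1) (j - 1))"
      "\<And>k j. \<lbrakk>k \<in> {1..m}; j \<in> {1..m}; I (s k j)\<rbrakk> \<Longrightarrow> I (s k (j - 1)) \<or> I (q j)"
    and mono: "\<And>k j. \<lbrakk>k \<in> {1..m}; j \<in> {1..m}; I (s k (j - 1))\<rbrakk> \<Longrightarrow> I (s k j)"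
    and count: "\<And>k j. \<lbrakk>k \<in> {1..m}; j \<in> {1..m}; I (s (k - 1) (j - 1)); I (q j)\<rbrakk> \<Longrightarrow> I (s k j)"
    and zero: "\<And>k j. \<lbrakk>j < k; k \<le> m\<rbrakk> \<Longrightarrow> \<not> I (s k j)" "\<And>j. j \<le> m \<Longrightarrow> I (s 0 j)"
    and low: "\<And>k j. \<lbrakk>k \<in> {1..m}; 2 * k - 2 + C < j; j \<le> m\<rbrakk> \<Longrightarrow> I (s k j)"
    and high: "\<And>k j. \<lbrakk>k \<in> {1..m}; j < 2 * k - C; j \<le> m\<rbrakk> \<Longrightarrow> \<not> I (s k j)"
    unfolding satisfies_counter_clauses_unfold by presburger+
  have A: "I (s k j) \<longleftrightarrow> k \<le> ?c j" if "k \<le> m" "j \<le> m" for k j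
    using that
  proof (induction j arbitrary: k)
    case 0
    then show ?case using zero by (cases "k = 0") auto
  next
    case (Suc j)
    show ?case
    proof (cases k)
      case 0
      then show ?thesis using zero Suc.prems by auto
    next
      case k: (Suc k')
      then have mem: "k \<in> {1..m}" "Suc j \<in> {1..m}" using Suc.prems by auto
      \<comment> \<open>The clauses in \<open>ex\<close> give the forward direction, distributing
        the disjunction over the conjunction; \<open>mono\<close> and \<open>count\<close> give the
        converse.\<close>
      have "I (s k (Suc j)) \<longleftrightarrow> I (s k j) \<or> (I (s k' j) \<and> I (q (Suc j)))"
        using ex[OF mem] mono[OF mem] count[OF mem] k by auto
      then show ?thesis
        using k Suc.prems Suc.IH[of k] Suc.IH[of k'] by auto
    qed
  qed
  moreover have "\<bar>2 * int (?c j) - int j\<bar> \<le> int C" if j: "j \<le> m" for j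
  proof (rule ccontr)
    assume "\<not> ?thesis"
    then consider "j + C < 2 * ?c j" | "2 * ?c j + C < j" by linarith
    then show False
    proof cases
      \<comment> \<open>Too many true entries: the count itself, as upper index, violates
        \<open>high\<close>.\<close>
      case 1
      moreover have "?c j \<le> m" using true_count_le[of "I \<circ> q" j] j by linarith
      ultimately have "?c j \<in> {1..m}" "j < 2 * ?c j - C" "I (s (?c j) j)" using A j by auto
      then show False using high j by blast
    next
      \<comment> \<open>Too few true entries: the least upper index not reached, one above the
        count, violates \<open>low\<close>.\<close>
      case 2
      then have "?c j + 1 \<in> {1..m}" "2 * (?c j + 1) - 2 + C < j" "\<not> I (s (?c j + 1) j)"
        using A j by auto
      then show False using low j by blast
    qed
  qed
  ultimately show "?A \<and> ?B" by blast
next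
  let ?c = "true_count (I \<circ> q)"
  assume AB: "?A \<and> ?B"
  then have s: "I (s k j) \<longleftrightarrow> k \<le> ?c j" if "k \<le> m" "j \<le> m" for k j
    using that by blast
  have bound: "2 * ?c j \<le> j + C" "j \<le> 2 * ?c j + C" if "j \<le> m" for j
    using AB that by (auto dest!: spec[where x = j])
  have step: "?c j = ?c (j - 1) + of_bool (I (q j))" if "j \<ge> 1" for j
    using that by (cases j) auto
  have le: "?c j \<le> j" for j by (rule true_count_le)
  show ?L
    unfolding satisfies_counter_clauses_unfold
  proof (intro conjI allI impI; (elim conjE)?)
    fix k j assume "j < k" "k \<le> m"
    then show "\<not> I (s k j)" using s[of k j] le[of j] by linarith
  next
    fix k j assume "k \<in> {1..m}" "2 * k - 2 + C < j" "j \<le> m"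
    then show "I (s k j)" using s[of k j] bound[of j] by auto
  next
    fix k j assume "k \<in> {1..m}" "j < 2 * k - C" "j \<le> m"
    then show "\<not> I (s k j)" using s[of k j] bound[of j] by auto
  qed (use s step in \<open>auto simp: of_bool_def split: if_splits\<close>)
qed

section \<open>Unit propagation on the counter clauses\<close>

lemma finite_counter_clauses_literals: "finite (\<Union>(counter_clauses C m q s))"
proof -
  define V where "V = q ` {..m} \<union> (\<lambda>(k, j). s k j) ` ({..m} \<times> {..m})"
  have V: "q j \<in> V" "s k j \<in> V" if "j \<le> m" "k \<le> m" for j k
    using that by (auto simp: V_def)
  have "\<Union>(counter_clauses C m q s) \<subseteq> Pos ` V \<union> Neg ` V"
    unfolding counter_clauses_def Union_Un_distrib Un_subset_iff
    by (intro conjI; clarsimp; auto intro!: V imageI)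
  moreover have "finite V"
    by (simp add: V_def)
  ultimately show ?thesis
    by (auto intro: finite_subset)
qed

lemma up_steps_CBound: "up_step\<^sup>*\<^sup>* (counter_clauses C m q s) (CBound C m q s)"
  \<comment> \<open>Finiteness ensures that the choice in \<open>unit_propagation\<close> is an
    actual result of propagation.\<close>
  using up_result_unit_propagation[OF finite_counter_clauses_literals]
  unfolding CBound_def up_result_def by blast

text \<open>Alternating inputs have prefix sums of absolute value at most 1, hence at most
  \<open>C\<close>. This supplies the models with both values of an input that
  \<open>satisfies_up_steps_extend\<close> asks for.\<close>

lemma counter_clauses_alternating_model:
  assumes "C \<ge> 1" "d \<ge> 1"
  shows "\<exists>M. satisfies M (counter_clauses C m (\<lambda>i. Inp (i * d)) (Aux d)) \<and> M (Inp (i * d)) = b"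
proof -
  define e where "e = (even i = b)"
  \<comment> \<open>Division by \<open>d\<close> recovers the position \<open>i\<close> from the
    input index \<open>i * d\<close>.\<close>
  define M where "M v = (case v of Inp x \<Rightarrow> even (x div d) = e
    | Aux _ k j \<Rightarrow> k \<le> true_count (\<lambda>i. even i = e) j)" for v
  have M: "M \<circ> (\<lambda>i. Inp (i * d)) = (\<lambda>i. even i = e)"
    using assms(2) by (auto simp: M_def)
  have "\<bar>2 * int (true_count (\<lambda>i. even i = e) j) - int j\<bar> \<le> int C" for j
    using true_count_alternating[of e j] assms(1) by linarith
  then have "satisfies M (counter_clauses C m (\<lambda>i. Inp (i * d)) (Aux d))"
    unfolding satisfies_counter_clauses_iff M by (simp add: M_def)
  moreover have "M (Inp (i * d)) = b"
    using fun_cong[OF M, of i] by (auto simp: e_def)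
  ultimately show ?thesis by blast
qed

section \<open>Discrepancy and the equivalence\<close>

lemma discrepancy_le_iff:
  assumes "n \<ge> 1"
  shows "discrepancy n x \<le> c \<longleftrightarrow>
    (\<forall>d\<ge>1. \<forall>k\<ge>1. k * d \<le> n \<longrightarrow> \<bar>\<Sum>i=1..k. x (i * d)\<bar> \<le> c)"
proof -
  let ?S = "{\<bar>\<Sum>i=1..k. x (i * d)\<bar> | d k. d \<ge> 1 \<and> k \<ge> 1 \<and> k * d \<le> n}"
  have S: "?S = (\<lambda>(d, k). \<bar>\<Sum>i=1..k. x (i * d)\<bar>) ` {(d, k). d \<ge> 1 \<and> k \<ge> 1 \<and> k * d \<le> n}"
    (is "_ = ?f ` ?P")
    by (auto simp: image_iff)
  \<comment> \<open>A factor of a positive product is at most the product; this makes the set under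
    \<open>Max\<close> finite.\<close>
  have "d \<le> n \<and> k \<le> n" if "d \<ge> 1" "k \<ge> 1" "k * d \<le> n" for d k :: nat
    using that mult_le_mono1[of 1 k d] mult_le_mono2[of 1 d k]
    unfolding mult_1 mult_1_right by linarith
  then have "?P \<subseteq> {..n} \<times> {..n}" by auto
  then have "finite ?P" by (rule finite_subset) auto
  moreover have "(1, 1) \<in> ?P" using assms by simp
  then have "?P \<noteq> {}" by blast
  ultimately have "Max (?f ` ?P) \<le> c \<longleftrightarrow> (\<forall>p\<in>?P. ?f p \<le> c)"
    by (subst Max_le_iff) auto
  then show ?thesis
    unfolding discrepancy_def S by auto
qed

theorem theorem2:
  fixes C n :: nat and I :: "edp_var \<Rightarrow> bool"
  assumes "C \<ge> 1" and "n \<ge> 1"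
  shows "(\<exists>I'. (\<forall>i\<in>{1..n}. I' (Inp i) = I (Inp i)) \<and> satisfies I' (EDP C n))
     \<longleftrightarrow> discrepancy n (\<lambda>i. 2 * of_bool (I (Inp i)) - 1) \<le> int C" (is "?L \<longleftrightarrow> ?R")
proof -
  let ?q = "\<lambda>d i. Inp (i * d)"
  let ?c = "\<lambda>d. true_count (\<lambda>i. I (Inp (i * d)))"
  have disc: "?R \<longleftrightarrow> (\<forall>d\<ge>1. \<forall>k\<ge>1. k * d \<le> n \<longrightarrow> \<bar>2 * int (?c d k) - int k\<bar> \<le> int C)"
    unfolding discrepancy_le_iff[OF assms(2)] sum_signs_eq ..
  show ?thesis
  proof
    assume ?L
    then obtain I' where I': "\<forall>i\<in>{1..n}. I' (Inp i) = I (Inp i)" "satisfies I' (EDP C n)"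
      by blast
    show ?R
      unfolding disc
    proof (intro allI impI)
      fix d k :: nat assume dk: "d \<ge> 1" "k \<ge> 1" "k * d \<le> n"
      show "\<bar>2 * int (?c d k) - int k\<bar> \<le> int C"
      proof (cases "d \<le> n div (C + 1)")
        case True
        let ?F = "counter_clauses C (n div d) (?q d) (Aux d)"
        have "satisfies I' (CBound C (n div d) (?q d) (Aux d))"
          using I'(2) True dk(1) unfolding EDP_def satisfies_def by auto
        \<comment> \<open>\<open>I'\<close> may be wrong on propagated auxiliary variables;
          \<open>J\<close> repairs them and keeps all inputs of this progression.\<close>
        from satisfies_up_steps_extend[OF up_steps_CBound this, of "range (?q d)"]
        obtain J where J: "\<forall>v\<in>range (?q d). J v = I' v" "satisfies J ?F"
          using counter_clauses_alternating_model[OF assms(1) dk(1)] by blast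
        have "k \<le> n div d"
          using dk by (simp add: less_eq_div_iff_mult_less_eq)
        then have "\<bar>2 * int (true_count (J \<circ> ?q d) k) - int k\<bar> \<le> int C"
          using J(2) unfolding satisfies_counter_clauses_iff by blast
        moreover have "true_count (J \<circ> ?q d) k = ?c d k"
          unfolding true_count_def
        proof (rule sum.cong)
          fix i assume "i \<in> {1..k}"
          then have "i * d \<in> {1..n}"
            using dk order_trans[OF mult_le_mono1[of i k d] dk(3)] by auto
          then show "of_bool ((J \<circ> ?q d) i) = of_bool (I (Inp (i * d)))"
            using I'(1) J(1) by auto
        qed simp
        ultimately show ?thesis by simp
      next
        case False
        then have "n div (C + 1) < d" by simp
        then have "n < d * (C + 1)" by (simp add: div_less_iff_less_mult)
        \<comment> \<open>Hence \<open>k\<close> is at most \<open>C\<close>, and a sum of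
          \<open>k\<close> signs cannot exceed \<open>C\<close> in absolute value.\<close>
        then have "k * d < (C + 1) * d" using dk(3) by (simp add: mult.commute)
        then have "k < C + 1" unfolding mult_less_cancel2 by blast
        then show ?thesis using true_count_le[of "\<lambda>i. I (Inp (i * d))" k] by linarith
      qed
    qed
  next
    assume R: ?R
    \<comment> \<open>Auxiliary variables get their intended counter values; as they carry
      \<open>d\<close>, one assignment serves all conjuncts.\<close>
    define I' where "I' v = (case v of Inp x \<Rightarrow> I (Inp x) | Aux d k j \<Rightarrow> k \<le> ?c d j)" for v
    have "satisfies I' (CBound C (n div d) (?q d) (Aux d))" if "d \<in> {1..n div (C + 1)}" for d
    proof (rule satisfies_up_steps[OF up_steps_CBound])
      have "\<bar>2 * int (?c d j) - int j\<bar> \<le> int C" if "j \<le> n div d" for j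
        using R[unfolded disc] \<open>d \<in> _\<close> that
        \<comment> \<open>The empty prefix is separate because the discrepancy only involves
          \<open>k \<ge> 1\<close>.\<close>
        by (cases "j = 0") (auto simp: less_eq_div_iff_mult_less_eq)
      moreover have "I' \<circ> ?q d = (\<lambda>i. I (Inp (i * d)))"
        by (auto simp: I'_def)
      ultimately show "satisfies I' (counter_clauses C (n div d) (?q d) (Aux d))"
        unfolding satisfies_counter_clauses_iff by (simp add: I'_def)
    qed
    then have "satisfies I' (EDP C n)" unfolding EDP_def satisfies_def by blast
    then show ?L by (intro exI[of _ I']) (auto simp: I'_def)
  qed
qed

end
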